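(* Let $f_1,\dots,f_m:\mathbb{R}^n\to\mathbb{R}$ be convex and continuously differentiable, and suppose that for each $i$ there is a constant $L_i$ with $\|\nabla f_i(x)-\nabla f_i(y)\|\le L_i\|x-y\|$ for all $x,y\in\mathbb{R}^n$; let $L:=\max_i L_i$. Let $F=(f_1,\dots,f_m)$ and suppose that for every $\bar x\in\mathbb{R}^n$ the level set $\mathcal{L}(F,F(\bar x))=\{x\in\mathbb{R}^n: f_i(x)\le f_i(\bar x),\ i=1,\dots,m\}$ is bounded. Suppose also that each $f_i$ is bounded below. Let $a\in[0,1)$, $b\in[\frac{a^2}{4},\frac14]$, $0<s\le\frac1L$, and let $\{x_k\}$ be the sequence generated by algorithm (MAG-GM) with these parameters. Then there exists $x^*\in\mathbb{R}^n$ such that $\lim_{k\to\infty}x_k=x^*$, and $x^*$ is a weakly Pareto optimal solution of $\min_{x\in\mathbb{R}^n}F(x)$.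
   Context: $\mathbb{R}^n$ carries the Euclidean inner product and norm. Algorithm (MAG-GM): choose $x_0=x_1\in\mathbb{R}^n$ and $t_1=1$; for $k\ge1$ set $$t_{k+1}=\sqrt{t_k^2-at_k+b}+\tfrac12,\qquad y_k=x_k+\frac{t_k-1}{t_{k+1}}(x_k-x_{k-1}),\qquad x_{k+1}=y_k-s\,\mathrm{proj}_{C(y_k)}\!\left(\tfrac1s(y_k-x_k)\right),$$ where $C(y):=\mathrm{conv}\{\nabla f_i(y):i=1,\dots,m\}$ and $\mathrm{proj}_K(v)$ is the Euclidean projection of $v$ onto the closed convex set $K$. Equivalently, $x_{k+1}=y_k-s\sum_{i=1}^m\theta_i^k\nabla f_i(y_k)$ where $\theta^k$ minimizes $\|s\sum_i\theta_i\nabla f_i(y_k)-(y_k-x_k)\|^2$ over $\theta\in\mathbb{R}^m$, $\theta\ge0$, $\sum_i\theta_i=1$. The iteration is run without stopping, so the sequences are infinite. A point $x^*\in\mathbb{R}^n$ is weakly Pareto optimal if there is no $y\in\mathbb{R}^n$ with $f_i(y)<f_i(x^* )$ for all $i=1,\dots,m$. *)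

theory Defs
  imports "HOL-Analysis.Analysis"
begin

definition grad :: "('a::real_inner \<Rightarrow> real) \<Rightarrow> 'a \<Rightarrow> 'a" where
  "grad f x = (THE D. GDERIV f x :> D)"

text \<open>Differentiability is required separately because \<^const>\<open>grad\<close> is
  unspecified at points where no gradient exists.\<close>

definition continuously_differentiable :: "('a::real_inner \<Rightarrow> real) \<Rightarrow> bool" where
  "continuously_differentiable f \<longleftrightarrow>
     (\<forall>x. f differentiable (at x)) \<and> continuous_on UNIV (grad f)"

definition level_set :: "('m \<Rightarrow> 'a \<Rightarrow> real) \<Rightarrow> ('m \<Rightarrow> real) \<Rightarrow> 'a set" where
  "level_set f \<alpha> = {x. \<forall>i. f i x \<le> \<alpha> i}"

definition grad_hull :: "('m::finite \<Rightarrow> 'a::euclidean_space \<Rightarrow> real) \<Rightarrow> 'a \<Rightarrow> 'a set" where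
  "grad_hull f y = convex hull (range (\<lambda>i. grad (f i) y))"

text \<open>The recursion runs over \<open>k \<ge> 1\<close>, so \<open>t 0\<close> and \<open>y 0\<close> are irrelevant and
  unconstrained. The projection \<^const>\<open>closest_point\<close> is well defined here since
  \<^const>\<open>grad_hull\<close> is nonempty, convex and compact.\<close>

definition mag_gm ::
  "('m::finite \<Rightarrow> 'a::euclidean_space \<Rightarrow> real) \<Rightarrow> real \<Rightarrow> real \<Rightarrow> real \<Rightarrow>
   (nat \<Rightarrow> real) \<Rightarrow> (nat \<Rightarrow> 'a) \<Rightarrow> (nat \<Rightarrow> 'a) \<Rightarrow> bool" where
  "mag_gm f a b s t y x \<longleftrightarrow>
     x 0 = x 1 \<and> t 1 = 1 \<and>
     (\<forall>k\<ge>1.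
        t (k + 1) = sqrt ((t k)\<^sup>2 - a * t k + b) + 1 / 2 \<and>
        y k = x k + ((t k - 1) / t (k + 1)) *\<^sub>R (x k - x (k - 1)) \<and>
        x (k + 1) = y k - s *\<^sub>R closest_point (grad_hull f (y k)) ((1 / s) *\<^sub>R (y k - x k)))"

definition weakly_pareto_optimal :: "('m \<Rightarrow> 'a \<Rightarrow> real) \<Rightarrow> 'a \<Rightarrow> bool" where
  "weakly_pareto_optimal f x \<longleftrightarrow> (\<nexists>y. \<forall>i. f i y < f i x)"

end

theory Submission
  imports Defs
begin

text \<open>
  Write \<open>\<Delta>\<^sub>k = x\<^sub>k - x\<^sub>k\<^sub>-\<^sub>1\<close>, \<open>z\<^sub>k = x\<^sub>k + (t\<^sub>k - 1) \<Delta>\<^sub>k\<close> and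
  \<open>\<sigma>\<^sub>k(z) = min\<^sub>i (f\<^sub>i(x\<^sub>k) - f\<^sub>i(z))\<close>. As for a single objective, the accelerated step decreases
  \<open>E\<^sub>k(z) = 2 s t\<^sub>k\<^sup>2 \<sigma>\<^sub>k(z) + \<parallel>z\<^sub>k - z\<parallel>\<^sup>2\<close> by at least \<open>2 s c\<^sub>k \<sigma>\<^sub>k(z)\<close>, where
  \<open>c\<^sub>k = a t\<^sub>k + 1/4 - b \<ge> 0\<close>. What is new with several objectives is that \<open>\<sigma>\<^sub>k(z)\<close> can be negative,
  so that \<open>E\<^sub>k(z)\<close> is neither obviously decreasing nor obviously bounded below.

  The remedy is that each mechanical energy \<open>f\<^sub>i(x\<^sub>k) + \<parallel>\<Delta>\<^sub>k\<parallel>\<^sup>2 / (2 s)\<close> decreases with \<open>k\<close>. It keeps the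
  iterates in a bounded level set, and at a cluster point \<open>z\<close> every \<open>f\<^sub>i(z)\<close> lies below all mechanical
  energies of index \<open>i\<close>. Hence \<open>2 s \<sigma>\<^sub>k(z) \<ge> - \<parallel>\<Delta>\<^sub>k\<parallel>\<^sup>2\<close>: the negative part of \<open>\<sigma>\<^sub>k(z)\<close> is controlled by
  the velocity. For such \<open>z\<close> a purely real-variable argument (\<open>energy_not_eventually_negative\<close>,
  \<open>energy_convergent\<close>, \<open>velocity_tendsto_0\<close>) shows that \<open>E\<^sub>k(z)\<close> converges and that \<open>\<Delta>\<^sub>k \<longlonglongrightarrow> 0\<close>.

  Two cluster points \<open>z\<close> and \<open>z'\<close> then have the same objective values, because by \<open>\<Delta>\<^sub>k \<longlonglongrightarrow> 0\<close> the
  mechanical energies tend to the objective values at either point. So the \<open>\<sigma>\<close>-terms cancel in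
  \<open>E\<^sub>k(z) - E\<^sub>k(z')\<close>, which is an affine function of the inner product of \<open>z\<^sub>k\<close> with \<open>z' - z\<close>. This inner
  product converges, hence so does the inner product of \<open>x\<^sub>k\<close> with \<open>z' - z\<close>, an average of the former
  (\<open>tendsto_if_extrapolation_tendsto\<close>). Comparing its limits along the two subsequences gives
  \<open>z = z'\<close> (\<open>cluster_points_equal\<close>), and a bounded sequence with one cluster point converges.

  If some \<open>u\<close> were better than the limit in all objectives, \<open>\<sigma>\<^sub>k(u)\<close> would eventually stay above a
  positive constant, so \<open>E\<^sub>k(u)\<close> would be decreasing and yet grow like \<open>t\<^sub>k\<^sup>2\<close>
  (\<open>limit_weakly_pareto_optimal\<close>).
\<close>

section \<open>Smooth convex functions\<close>

lemma GDERIV_grad: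
  fixes f :: "'a::euclidean_space \<Rightarrow> real"
  assumes "f differentiable (at u)"
  shows "GDERIV f u :> grad f u"
proof -
  obtain D where D: "(f has_derivative D) (at u)"
    using assms by (auto simp: differentiable_def)
  \<comment> \<open>The Riesz representative of the derivative.\<close>
  define v where "v = (\<Sum>b\<in>Basis. D b *\<^sub>R b)"
  have "D h = h \<bullet> v" for h
  proof -
    have "D h = D (\<Sum>b\<in>Basis. (h \<bullet> b) *\<^sub>R b)"
      by (simp add: euclidean_representation)
    also have "\<dots> = (\<Sum>b\<in>Basis. (h \<bullet> b) * D b)"
      using has_derivative_linear[OF D] by (simp add: linear_sum linear_cmul)
    also have "\<dots> = h \<bullet> v"
      by (simp add: v_def inner_sum_right mult.commute)
    finally show ?thesis .
  qed
  then have v: "GDERIV f u :> v"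
    using D by (simp add: gderiv_def) (metis (no_types, lifting) ext)
  moreover have "w = v" if "GDERIV f u :> w" for w
  proof -
    have "(\<lambda>h. h \<bullet> w) = (\<lambda>h. h \<bullet> v)"
      using v that unfolding gderiv_def by (rule has_derivative_unique[rotated])
    then have "(w - v) \<bullet> (w - v) = 0"
      by (metis inner_diff_right right_minus_eq)
    then show ?thesis by simp
  qed
  ultimately show ?thesis
    unfolding grad_def by (rule theI)
qed

lemma GDERIV_along_line:
  assumes "GDERIV f (u + r *\<^sub>R w) :> g"
  shows "((\<lambda>r. f (u + r *\<^sub>R w)) has_real_derivative g \<bullet> w) (at r)"
proof -
  have "((\<lambda>r. u + r *\<^sub>R w) has_derivative (\<lambda>h. h *\<^sub>R w)) (at r)"
    by (auto intro!: derivative_eq_intros)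
  then have "((\<lambda>r. f (u + r *\<^sub>R w)) has_derivative (\<lambda>h. (h *\<^sub>R w) \<bullet> g)) (at r)"
    using assms unfolding gderiv_def by (rule has_derivative_compose)
  then show ?thesis
    by (rule has_derivative_imp_has_field_derivative) (simp add: inner_commute)
qed

text \<open>
  Restricting to the line through \<open>u\<close> and \<open>v\<close> reduces this to the tangent of a convex function of one
  real variable.
\<close>

lemma convex_on_gradient_below:
  fixes f :: "'a::real_inner \<Rightarrow> real"
  assumes "convex_on UNIV f" and "GDERIV f u :> g"
  shows "f u + g \<bullet> (v - u) \<le> f v"
proof -
  define \<phi> where "\<phi> r = f (u + r *\<^sub>R (v - u))" for r :: real
  have "convex_on UNIV \<phi>"
  proof (rule convex_onI)
    fix r p q :: real
    assume "0 < r" "r < 1"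
    have "u + ((1 - r) * p + r * q) *\<^sub>R (v - u)
      = (1 - r) *\<^sub>R (u + p *\<^sub>R (v - u)) + r *\<^sub>R (u + q *\<^sub>R (v - u))"
      by (simp add: algebra_simps)
    then show "\<phi> ((1 - r) *\<^sub>R p + r *\<^sub>R q) \<le> (1 - r) * \<phi> p + r * \<phi> q"
      using convex_onD[OF assms(1), of r "u + p *\<^sub>R (v - u)" "u + q *\<^sub>R (v - u)"] \<open>0 < r\<close> \<open>r < 1\<close>
      by (simp add: \<phi>_def)
  qed simp
  moreover have "(\<phi> has_real_derivative g \<bullet> (v - u)) (at 0)"
    unfolding \<phi>_def[abs_def] using assms(2) by (intro GDERIV_along_line) simp
  ultimately have "\<phi> 1 - \<phi> 0 \<ge> (g \<bullet> (v - u)) * (1 - 0)"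
    by (intro convex_on_imp_above_tangent[where A = UNIV]) auto
  then show ?thesis by (simp add: \<phi>_def)
qed

text \<open>
  Along the segment from \<open>u\<close> to \<open>v\<close>, the difference of the two sides has a derivative of constant sign
  by the Cauchy-Schwarz inequality.
\<close>

lemma smooth_quadratic_above:
  fixes f :: "'a::real_inner \<Rightarrow> real"
  assumes deriv: "\<And>w. GDERIV f w :> g w"
    and lipschitz: "\<And>w w'. norm (g w - g w') \<le> L * norm (w - w')"
  shows "f v \<le> f u + g u \<bullet> (v - u) + L / 2 * (norm (v - u))\<^sup>2"
proof -
  define \<phi> where
    "\<phi> r = f (u + r *\<^sub>R (v - u)) - r * (g u \<bullet> (v - u)) - L * r\<^sup>2 / 2 * (norm (v - u))\<^sup>2"
    for r :: real
  have "\<exists>D. (\<phi> has_real_derivative D) (at r) \<and> D \<le> 0" if "0 \<le> r" for r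
  proof (intro exI conjI)
    let ?w = "u + r *\<^sub>R (v - u)"
    show "(\<phi> has_real_derivative (g ?w \<bullet> (v - u) - g u \<bullet> (v - u) - L * r * (norm (v - u))\<^sup>2)) (at r)"
      unfolding \<phi>_def[abs_def]
      by (auto intro!: derivative_eq_intros GDERIV_along_line deriv)
    have "(g ?w - g u) \<bullet> (v - u) \<le> norm (g ?w - g u) * norm (v - u)"
      by (rule norm_cauchy_schwarz)
    also have "\<dots> \<le> (L * norm (?w - u)) * norm (v - u)"
      by (intro mult_right_mono lipschitz) simp
    also have "\<dots> = L * r * (norm (v - u))\<^sup>2"
      using that by (simp add: power2_eq_square)
    finally show "g ?w \<bullet> (v - u) - g u \<bullet> (v - u) - L * r * (norm (v - u))\<^sup>2 \<le> 0"
      by (simp add: inner_diff_left)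
  qed
  then have "\<phi> 1 \<le> \<phi> 0"
    by (intro DERIV_nonpos_imp_nonincreasing[OF zero_le_one]) blast
  then show ?thesis by (simp add: \<phi>_def)
qed

section \<open>Sequences of real numbers\<close>

lemma eventually_antimono_convergent:
  fixes u :: "nat \<Rightarrow> real"
  assumes "\<And>k. k \<ge> K \<Longrightarrow> u (k + 1) \<le> u k" and "\<And>k. k \<ge> K \<Longrightarrow> m \<le> u k"
  shows "convergent u"
proof -
  have "decseq (\<lambda>n. u (n + K))"
    using assms(1) by (intro decseq_SucI) (metis Suc_eq_plus1 add_Suc le_add2)
  then obtain l where "(\<lambda>n. u (n + K)) \<longlonglongrightarrow> l"
    using assms(2) by (metis decseq_convergent le_add2)
  then show ?thesis
    by (metis LIMSEQ_offset convergent_def)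
qed

lemma eventually_antimono_le:
  fixes u :: "nat \<Rightarrow> real"
  assumes "\<And>k. k \<ge> K \<Longrightarrow> u (k + 1) \<le> u k" and "K \<le> m" and "m \<le> n"
  shows "u n \<le> u m"
  using \<open>m \<le> n\<close>
proof (induction n rule: dec_induct)
  case (step n)
  then show ?case using assms(1)[of n] assms(2) by simp
qed simp

text \<open>
  The increments are eventually below any positive constant, so \<open>u\<close> grows more slowly than any linear
  function. Both averaging arguments below, for the iterates and for the velocity, reduce to this.
\<close>

lemma vanishing_increments_sublinear:
  fixes u r T :: "nat \<Rightarrow> real"
  assumes increment: "\<And>k. k \<ge> K \<Longrightarrow> u (k + 1) \<le> u k + r k"
    and "r \<longlonglongrightarrow> 0" and nonneg: "\<And>k. k \<ge> K \<Longrightarrow> 0 \<le> u k"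
    and "0 < \<kappa>" and growth: "\<And>k. k \<ge> 1 \<Longrightarrow> \<kappa> * real k \<le> T k"
  shows "(\<lambda>n. u n / T n) \<longlonglongrightarrow> 0"
proof (rule LIMSEQ_I)
  fix e :: real
  assume "0 < e"
  \<comment> \<open>Half of \<open>e\<close> is left for the initial value \<open>u N\<close>.\<close>
  define \<epsilon> where "\<epsilon> = e * \<kappa> / 2"
  have "0 < \<epsilon>" using \<open>0 < e\<close> \<open>0 < \<kappa>\<close> by (simp add: \<epsilon>_def)
  then obtain N0 where N0: "\<And>k. k \<ge> N0 \<Longrightarrow> \<bar>r k\<bar> < \<epsilon>"
    using \<open>r \<longlonglongrightarrow> 0\<close> by (metis LIMSEQ_D diff_zero real_norm_def)
  define N where "N = max K N0"
  then have "K \<le> N" by simp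
  have linear: "u n \<le> u N + \<epsilon> * real (n - N)" if "N \<le> n" for n
    using that
  proof (induction n rule: dec_induct)
    case (step n)
    then have "u (Suc n) \<le> u n + \<epsilon>"
      using increment[of n] N0[of n] by (simp add: N_def)
    then show ?case using step by (simp add: Suc_diff_le algebra_simps)
  qed simp
  obtain M where M: "u N < real M * \<epsilon>"
    using reals_Archimedean3[OF \<open>0 < \<epsilon>\<close>] by blast
  have "norm (u n / T n - 0) < e" if n: "n \<ge> max (N + 1) M" for n
  proof -
    have "\<epsilon> * real (n - N) \<le> \<epsilon> * real n"
      using \<open>0 < \<epsilon>\<close> by simp
    moreover have "real M * \<epsilon> \<le> \<epsilon> * real n"
      using n \<open>0 < \<epsilon>\<close> by (simp add: mult.commute)
    moreover have "u n \<le> u N + \<epsilon> * real (n - N)"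
      using linear n by simp
    ultimately have "u n < \<epsilon> * real n + \<epsilon> * real n"
      using M by linarith
    also have "\<epsilon> * real n + \<epsilon> * real n = e * (\<kappa> * real n)"
      by (simp add: \<epsilon>_def)
    also have "\<dots> \<le> e * T n"
      using growth[of n] n \<open>0 < e\<close> by simp
    finally have "u n < e * T n" .
    moreover have "0 < T n"
      using growth[of n] n \<open>0 < \<kappa>\<close>
      by (smt (verit) mult_pos_pos of_nat_0_less_iff le_add2 le_trans max.bounded_iff not_one_le_zero zero_less_iff_neq_zero)
    moreover have "0 \<le> u n" using nonneg[of n] n \<open>K \<le> N\<close> by simp
    ultimately show ?thesis by (simp add: field_simps)
  qed
  then show "\<exists>no. \<forall>n\<ge>no. norm (u n / T n - 0) < e" by blast
qed

section \<open>Inertial weights\<close>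

text \<open>
  The properties of the weights \<open>t\<close> on which the convergence argument rests. The defect \<open>c\<close> measures by how
  much they fall short of Nesterov's extremal recursion \<open>t\<^sub>k\<^sub>+\<^sub>1\<^sup>2 - t\<^sub>k\<^sub>+\<^sub>1 = t\<^sub>k\<^sup>2\<close>.
\<close>

locale inertial_weights =
  fixes t c :: "nat \<Rightarrow> real" and \<kappa> :: real
  assumes weight_ge_1: "\<And>k. k \<ge> 1 \<Longrightarrow> 1 \<le> t k"
    and rate_pos: "0 < \<kappa>"
    and weight_growth: "\<And>k. k \<ge> 1 \<Longrightarrow> \<kappa> * real k \<le> t k"
    and weight_mono: "\<And>k. k \<ge> 1 \<Longrightarrow> t k \<le> t (k + 1)"
    and weight_step: "\<And>k. k \<ge> 1 \<Longrightarrow> t (k + 1) \<le> t k + 1"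
    and weight_square: "\<And>k. k \<ge> 1 \<Longrightarrow> (t (k + 1))\<^sup>2 - (t k)\<^sup>2 = t (k + 1) - c k"
    and defect_nonneg: "\<And>k. k \<ge> 1 \<Longrightarrow> 0 \<le> c k"
    and defect_ratio: "\<And>k. k \<ge> 1 \<Longrightarrow> c (k + 1) / t (k + 1) \<le> c k / t k"
begin

lemma weights_at_top: "filterlim t at_top sequentially"
proof (rule filterlim_at_top_mono)
  show "filterlim (\<lambda>k. \<kappa> * real k) at_top sequentially"
    using rate_pos by (intro filterlim_tendsto_pos_mult_at_top[OF tendsto_const] filterlim_real_sequentially)
  show "\<forall>\<^sub>F k in sequentially. \<kappa> * real k \<le> t k"
    using weight_growth by (auto simp: eventually_sequentially)
qed

lemma weights_eventually_ge: "\<exists>K\<ge>1. \<forall>k\<ge>K. M \<le> t k"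
proof -
  obtain K where "\<forall>k\<ge>K. M \<le> t k"
    using weights_at_top by (auto simp: filterlim_at_top eventually_sequentially)
  then show ?thesis by (intro exI[of _ "max 1 K"]) simp
qed

text \<open>
  Solving for \<open>h k\<close> writes it as the average of \<open>h (k - 1)\<close> and the extrapolated value with weights
  \<open>1 - 1 / t k\<close> and \<open>1 / t k\<close>. The latter weights are not summable, so \<open>h\<close> forgets its initial value and
  follows the limit of the extrapolated values.
\<close>

lemma tendsto_if_extrapolation_tendsto:
  fixes h :: "nat \<Rightarrow> real"
  assumes "(\<lambda>k. t k * h k - (t k - 1) * h (k - 1)) \<longlonglongrightarrow> l"
  shows "h \<longlonglongrightarrow> l"
proof -
  define e where "e k = h k - l" for k
  define r where "r k = t k * e k - (t k - 1) * e (k - 1)" for k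
  have r: "r k = t k * h k - (t k - 1) * h (k - 1) - l" for k
    by (simp add: r_def e_def algebra_simps)
  have "r \<longlonglongrightarrow> 0"
    unfolding r[abs_def] using assms by (auto intro: tendsto_eq_intros)
  then have lim: "(\<lambda>k. \<bar>r (k + 1)\<bar>) \<longlonglongrightarrow> 0"
    by (metis LIMSEQ_ignore_initial_segment tendsto_rabs_zero)
  have "(\<lambda>k. (t k * \<bar>e k\<bar>) / t k) \<longlonglongrightarrow> 0"
  proof (rule vanishing_increments_sublinear[OF _ lim _ rate_pos weight_growth, where K = 1])
    fix k :: nat
    assume k: "k \<ge> 1"
    have "t (k + 1) * \<bar>e (k + 1)\<bar> = \<bar>(t (k + 1) - 1) * e k + r (k + 1)\<bar>"
      using weight_ge_1[of "k + 1"] by (simp add: r_def abs_mult)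
    also have "\<dots> \<le> (t (k + 1) - 1) * \<bar>e k\<bar> + \<bar>r (k + 1)\<bar>"
      using weight_ge_1[of "k + 1"] abs_triangle_ineq[of "(t (k + 1) - 1) * e k" "r (k + 1)"]
      by (simp add: abs_mult)
    \<comment> \<open>Weights growing by at most 1 make the coefficient of the previous error no larger than \<open>t k\<close>.\<close>
    also have "\<dots> \<le> t k * \<bar>e k\<bar> + \<bar>r (k + 1)\<bar>"
      using weight_step[OF k] by (simp add: mult_right_mono)
    finally show "t (k + 1) * \<bar>e (k + 1)\<bar> \<le> t k * \<bar>e k\<bar> + \<bar>r (k + 1)\<bar>" .
  next
    fix k :: nat
    assume "k \<ge> 1"
    then show "0 \<le> t k * \<bar>e k\<bar>" using weight_ge_1[of k] by simp
  qed simp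
  moreover have "\<forall>\<^sub>F k in sequentially. (t k * \<bar>e k\<bar>) / t k = \<bar>e k\<bar>"
    using weight_ge_1 by (intro eventually_sequentiallyI[of 1]) fastforce
  ultimately have "(\<lambda>k. \<bar>e k\<bar>) \<longlonglongrightarrow> 0"
    by (rule Lim_transform_eventually)
  then have "e \<longlonglongrightarrow> 0" by (simp add: tendsto_rabs_zero_iff)
  then show ?thesis by (simp add: e_def[abs_def] LIM_zero_iff)
qed

end

section \<open>Convergence of the energy\<close>

text \<open>
  The scalar relations that the iterates satisfy with respect to a reference point \<open>z\<close>: \<open>E\<close> is the energy,
  \<open>D\<close> the squared velocity \<open>\<parallel>\<Delta>\<^sub>k\<parallel>\<^sup>2\<close>, \<open>d\<close> the squared distance to \<open>z\<close>, and \<open>G\<close> is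
  \<open>t\<^sub>k\<^sup>2 (2 s \<sigma>\<^sub>k(z) + \<parallel>\<Delta>\<^sub>k\<parallel>\<^sup>2)\<close>, the gap after compensating its possible negativity by the velocity.
\<close>

locale inertial_energy = inertial_weights +
  fixes E G D d :: "nat \<Rightarrow> real"
  assumes energy_step: "\<And>k. k \<ge> 1 \<Longrightarrow> E (k + 1) \<le> E k - c k * (G k / (t k)\<^sup>2 - D k)"
    and gap_step: "\<And>k. k \<ge> 1 \<Longrightarrow> G (k + 1) \<le> G k
        + ((t (k + 1))\<^sup>2 - (t k)\<^sup>2) * (G k / (t k)\<^sup>2) - ((t (k + 1))\<^sup>2 - (t k - 1)\<^sup>2) * D k"
    and energy_gap: "\<And>k. k \<ge> 1 \<Longrightarrow> E k = G k - t k * D k + t k * d k - (t k - 1) * d (k - 1)"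
    and gap_nonneg: "\<And>k. k \<ge> 1 \<Longrightarrow> 0 \<le> G k"
    and velocity_nonneg: "\<And>k. 0 \<le> D k"
    and distance_nonneg: "\<And>k. 0 \<le> d k"
begin

text \<open>
  The energy can increase by \<open>c k * D k\<close> in one step, whereas \<open>G\<close> decreases by about \<open>2 * t k * D k\<close> up to
  terms in \<open>G\<close>. The coefficient of \<open>G\<close> is chosen so that the sum absorbs both positive contributions;
  \<open>2 / 3\<close> lies strictly between the values \<open>1 / 2\<close> and \<open>1\<close> that these two requirements impose.
\<close>

definition lyapunov :: "nat \<Rightarrow> real" where
  "lyapunov k = E k + 2 / 3 * (c k / t k) * G k"

text \<open>
  Dividing the energy by \<open>t k\<close> turns the distance terms into the increments of \<open>d\<close>; the part with \<open>G\<close>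
  compensates the velocity terms.
\<close>

definition potential :: "nat \<Rightarrow> real" where
  "potential k = d (k - 1) + G k / 15"

text \<open>
  The exact coefficients of \<open>gap_step\<close> replaced by their leading terms: as \<open>t (k + 1)\<^sup>2 - t k\<^sup>2\<close> is at most
  \<open>t k + 1\<close>, it is at most \<open>9 / 8 * t k\<close> once \<open>t k\<close> reaches \<open>8\<close>.
\<close>

lemma gap_step_asymptotic:
  assumes "k \<ge> 1" and "8 \<le> t k"
  shows "G (k + 1) \<le> G k + 9 / 8 * (G k / t k) - (2 * t k - 1) * D k"
proof -
  define A where "A = (t (k + 1))\<^sup>2 - (t k)\<^sup>2"
  have "0 \<le> A"
    unfolding A_def using weight_mono[OF assms(1)] assms(2) by (simp add: power_mono)
  have "A \<le> t k + 1"
    unfolding A_def using weight_square weight_step defect_nonneg assms(1) by fastforce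
  have "A * (G k / (t k)\<^sup>2) = (A / t k) * (G k / t k)"
    by (simp add: power2_eq_square)
  also have "\<dots> \<le> 9 / 8 * (G k / t k)"
    using \<open>A \<le> t k + 1\<close> assms gap_nonneg[of k] by (intro mult_right_mono) (auto simp: field_simps)
  finally have "A * (G k / (t k)\<^sup>2) \<le> 9 / 8 * (G k / t k)" .
  moreover have "((t (k + 1))\<^sup>2 - (t k - 1)\<^sup>2) * D k = A * D k + (2 * t k - 1) * D k"
    by (simp add: A_def power2_eq_square algebra_simps)
  moreover have "0 \<le> A * D k" using \<open>0 \<le> A\<close> velocity_nonneg by simp
  ultimately show ?thesis
    using gap_step[OF assms(1), folded A_def] by linarith
qed

lemma weighted_energy_lower:
  assumes k: "k \<ge> 1" and t: "8 \<le> t k"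
  shows "G k / (2 * t k) + potential (k + 1) - potential k \<le> E k / t k"
proof -
  \<comment> \<open>Here \<open>15\<close> is \<open>2 * 8 - 1\<close>, the least value of \<open>2 * t k - 1\<close>.\<close>
  have "15 * D k \<le> (2 * t k - 1) * D k"
    using t velocity_nonneg[of k] by (intro mult_right_mono) auto
  then have "15 * D k \<le> G k - G (k + 1) + 9 / 8 * (G k / t k)"
    using gap_step_asymptotic[OF assms] by linarith
  moreover have "E k / t k = G k / t k - D k + d k - d (k - 1) + d (k - 1) / t k"
    using energy_gap[OF k] t by (simp add: field_simps)
  moreover have "0 \<le> d (k - 1) / t k" "0 \<le> G k / t k"
    using distance_nonneg[of "k - 1"] gap_nonneg[OF k] t by auto
  ultimately show ?thesis
    by (simp add: potential_def field_simps)
qed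

text \<open>
  An energy below \<open>-1\<close> would decrease the nonnegative potential by at least \<open>1 / t k\<close> in each step, and
  \<open>\<Sum>1 / t k\<close> diverges. The divergence is expressed by \<open>1 / t k \<ge> ln (t (k + 1)) - ln (t k)\<close>, so that
  the potential plus \<open>ln (t k)\<close> would be decreasing although \<open>t\<close> is unbounded.
\<close>

lemma energy_not_eventually_negative: "\<not> (\<forall>k\<ge>n. E k \<le> -1)"
proof
  assume neg: "\<forall>k\<ge>n. E k \<le> -1"
  obtain K0 where "K0 \<ge> 1" and "\<forall>k\<ge>K0. 8 \<le> t k"
    using weights_eventually_ge by blast
  then obtain K where K: "K \<ge> 1" "K \<ge> n" "\<And>k. k \<ge> K \<Longrightarrow> 8 \<le> t k"
    by (metis le_trans max.cobounded1 max.cobounded2)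
  have step: "potential (k + 1) + ln (t (k + 1)) \<le> potential k + ln (t k)" if "k \<ge> K" for k
  proof -
    have k: "k \<ge> 1" "8 \<le> t k" "8 \<le> t (k + 1)" using that K by auto
    have "ln (t (k + 1)) - ln (t k) = ln (t (k + 1) / t k)"
      using k by (simp add: ln_div)
    also have "\<dots> \<le> t (k + 1) / t k - 1"
      using k by (intro ln_le_minus_one) simp
    also have "\<dots> \<le> 1 / t k"
      using divide_right_mono[OF weight_step[OF k(1)], of "t k"] k by (simp add: add_divide_distrib)
    finally have "ln (t (k + 1)) - ln (t k) \<le> 1 / t k" .
    moreover have "E k / t k \<le> - (1 / t k)"
      using neg that K(2) k by (simp add: field_simps)
    moreover have "0 \<le> G k / (2 * t k)"
      using gap_nonneg k by simp
    ultimately show ?thesis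
      using weighted_energy_lower[OF k(1,2)] by linarith
  qed
  define C where "C = potential K + ln (t K)"
  have "ln (t k) \<le> C" if "k \<ge> K" for k
  proof -
    have "potential k + ln (t k) \<le> C"
      unfolding C_def by (rule eventually_antimono_le[where u = "\<lambda>k. potential k + ln (t k)", OF step order_refl that])
    moreover have "0 \<le> potential k"
      using distance_nonneg gap_nonneg[of k] that K(1) by (simp add: potential_def)
    ultimately show ?thesis by linarith
  qed
  then have "t k \<le> exp C" if "k \<ge> K" for k
    using that K(3)[OF that] by (metis exp_le_cancel_iff exp_ln less_le_trans zero_less_numeral)
  moreover obtain K' where "\<forall>k\<ge>K'. exp C + 1 \<le> t k"
    using weights_eventually_ge by blast
  ultimately have "exp C + 1 \<le> exp C"
    by (meson max.cobounded1 max.cobounded2 order_trans)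
  then show False by simp
qed

lemma lyapunov_step:
  assumes k: "k \<ge> 1" and t: "8 \<le> t k"
  shows "lyapunov (k + 1) \<le> lyapunov k - c k * D k / 4"
proof -
  define \<mu> where "\<mu> = 2 / 3 * (c k / t k)"
  have \<mu>: "0 \<le> \<mu>" "\<mu> * t k = 2 / 3 * c k"
    using defect_nonneg[OF k] t by (auto simp: \<mu>_def)
  have G: "0 \<le> G k / t k" and c: "0 \<le> c k" and D: "0 \<le> D k"
    using gap_nonneg[OF k] defect_nonneg[OF k] velocity_nonneg t by auto
  have "2 / 3 * (c (k + 1) / t (k + 1)) * G (k + 1) \<le> \<mu> * G (k + 1)"
    unfolding \<mu>_def using defect_ratio[OF k] gap_nonneg[of "k + 1"] by (intro mult_right_mono) auto
  also have "\<dots> \<le> \<mu> * (G k + 9 / 8 * (G k / t k) - (2 * t k - 1) * D k)"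
    using gap_step_asymptotic[OF assms] \<mu>(1) by (intro mult_left_mono)
  also have "\<dots> = \<mu> * G k + 9 / 8 * (\<mu> * t k) * (G k / (t k)\<^sup>2) - 2 * (\<mu> * t k) * D k + \<mu> * D k"
    using t by (simp add: power2_eq_square field_simps)
  also have "\<dots> = \<mu> * G k + 3 / 4 * (c k * (G k / (t k)\<^sup>2)) - 4 / 3 * (c k * D k) + \<mu> * D k"
    unfolding \<mu>(2) by simp
  also have "\<mu> * D k \<le> c k * D k / 12"
  proof -
    have "\<mu> \<le> c k / 12"
      using \<mu> t mult_left_mono[OF t \<mu>(1)] by simp
    then show ?thesis using D mult_right_mono by fastforce
  qed
  finally have "2 / 3 * (c (k + 1) / t (k + 1)) * G (k + 1)
      \<le> \<mu> * G k + 3 / 4 * (c k * (G k / (t k)\<^sup>2)) - 5 / 4 * (c k * D k)"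
    by linarith
  moreover have "0 \<le> c k * (G k / (t k)\<^sup>2)"
    using gap_nonneg[OF k] c by simp
  ultimately show ?thesis
    using energy_step[OF k] by (simp add: lyapunov_def \<mu>_def algebra_simps)
qed

text \<open>
  The Lyapunov function is eventually decreasing and dominates the energy, so
  \<open>energy_not_eventually_negative\<close> bounds it below. Its decrease pays for the increase \<open>c k * D k\<close> of the
  energy: \<open>E + 4 lyapunov\<close> is decreasing too, and bounded below for the same reason.
\<close>

proposition energy_convergent: "convergent E"
proof -
  obtain K where K: "K \<ge> 1" "\<And>k. k \<ge> K \<Longrightarrow> 8 \<le> t k"
    using weights_eventually_ge by blast
  have lyapunov: "lyapunov (k + 1) \<le> lyapunov k" if "k \<ge> K" for k
    using lyapunov_step[of k] defect_nonneg[of k] velocity_nonneg[of k] K that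
    by (smt (verit) divide_nonneg_nonneg le_trans mult_nonneg_nonneg)
  have E_le: "E k \<le> lyapunov k" if "k \<ge> K" for k
    using gap_nonneg[of k] defect_nonneg[of k] weight_ge_1[of k] K that by (simp add: lyapunov_def)
  have lyapunov_lower: "-1 \<le> lyapunov k" if "k \<ge> K" for k
  proof (rule ccontr)
    assume "\<not> -1 \<le> lyapunov k"
    then have "E j \<le> -1" if "j \<ge> k" for j
      using eventually_antimono_le[of K lyapunov k j, OF lyapunov] E_le[of j] \<open>k \<ge> K\<close> that by fastforce
    then show False using energy_not_eventually_negative by blast
  qed
  define V where "V k = E k + 4 * lyapunov k" for k
  have V: "V (k + 1) \<le> V k" if "k \<ge> K" for k
  proof -
    have "0 \<le> c k * (G k / (t k)\<^sup>2)"
      using gap_nonneg[of k] defect_nonneg[of k] K that by simp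
    then show ?thesis
      using energy_step[of k] lyapunov_step[of k] K that by (simp add: V_def algebra_simps)
  qed
  \<comment> \<open>Below \<open>-5\<close>, the bound \<open>-1\<close> on the Lyapunov function would force the energy below \<open>-1\<close>.\<close>
  have V_lower: "-5 \<le> V k" if "k \<ge> K" for k
  proof (rule ccontr)
    assume "\<not> -5 \<le> V k"
    then have "E j \<le> -1" if "j \<ge> k" for j
      using eventually_antimono_le[of K V k j, OF V] lyapunov_lower[of j] \<open>k \<ge> K\<close> that
      by (simp add: V_def)
    then show False using energy_not_eventually_negative by blast
  qed
  have "convergent V"
    by (rule eventually_antimono_convergent[where u = V and K = K, OF V V_lower])
  moreover have "convergent lyapunov"
    by (rule eventually_antimono_convergent[where u = lyapunov and K = K, OF lyapunov lyapunov_lower])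
  ultimately have "convergent (\<lambda>k. V k - 4 * lyapunov k)"
    by (intro convergent_diff convergent_mult convergent_const)
  then show ?thesis by (simp add: V_def)
qed

text \<open>
  For a bounded energy the combination \<open>Q\<close> of \<open>G\<close> and the potential, which dominates \<open>t k * D k\<close> up to a
  vanishing term, has increments of order at most \<open>1 / t k\<close>. Hence it grows sublinearly, and dividing by
  \<open>t k\<close> leaves a null sequence.
\<close>

proposition velocity_tendsto_0: "D \<longlonglongrightarrow> 0"
proof -
  obtain K where K: "K \<ge> 1" "\<And>k. k \<ge> K \<Longrightarrow> 8 \<le> t k"
    using weights_eventually_ge by blast
  obtain M where M: "M > 0" "\<And>k. \<bar>E k\<bar> \<le> M"
    using energy_convergent by (metis convergent_imp_Bseq BseqE real_norm_def)
  \<comment> \<open>The factor \<open>9 / 4\<close> cancels the term \<open>9 / 8 * (G k / t k)\<close> against \<open>G k / (2 * t k)\<close>.\<close>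
  define Q where "Q k = G k + 9 / 4 * potential k" for k
  define r where "r k = 9 / 4 * M * inverse (t k)" for k
  have step: "t k * D k + Q (k + 1) \<le> Q k + r k" if "k \<ge> K" for k
  proof -
    have k: "k \<ge> 1" "8 \<le> t k" using K that by auto
    have "t k * D k \<le> (2 * t k - 1) * D k"
      using k velocity_nonneg[of k] by (intro mult_right_mono) auto
    moreover have "E k / t k \<le> M * inverse (t k)"
      using M(2)[of k] k by (simp add: field_simps abs_le_iff)
    moreover have "G k / (2 * t k) = G k / t k / 2" by simp
    ultimately show ?thesis
      using gap_step_asymptotic[OF k] weighted_energy_lower[OF k] unfolding Q_def r_def by linarith
  qed
  have Q: "0 \<le> Q k" if "k \<ge> K" for k
    using gap_nonneg[of k] distance_nonneg K(1) that by (simp add: Q_def potential_def)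
  have r: "r \<longlonglongrightarrow> 0"
    unfolding r_def[abs_def] using tendsto_inverse_0_at_top[OF weights_at_top]
    by (auto intro: tendsto_eq_intros)
  have "(\<lambda>n. Q n / t n) \<longlonglongrightarrow> 0"
  proof (rule vanishing_increments_sublinear[OF _ r Q rate_pos weight_growth])
    fix k
    assume "k \<ge> K"
    then have "0 \<le> t k * D k" using K(2)[of k] velocity_nonneg[of k] by simp
    then show "Q (k + 1) \<le> Q k + r k" using step[OF \<open>k \<ge> K\<close>] by linarith
  qed auto
  moreover have "(\<lambda>n. r n * inverse (t n)) \<longlonglongrightarrow> 0 * 0"
    by (intro tendsto_mult r tendsto_inverse_0_at_top weights_at_top)
  ultimately have upper: "(\<lambda>n. Q n / t n + r n * inverse (t n)) \<longlonglongrightarrow> 0"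
    by (auto intro: tendsto_eq_intros)
  show ?thesis
  proof (rule tendsto_sandwich[OF _ _ tendsto_const upper])
    show "\<forall>\<^sub>F n in sequentially. D n \<le> Q n / t n + r n * inverse (t n)"
    proof (rule eventually_sequentiallyI)
      fix n
      assume n: "n \<ge> K"
      then show "D n \<le> Q n / t n + r n * inverse (t n)"
        using step[OF n] Q[of "n + 1"] K(2)[OF n] by (simp add: field_simps)
    qed
  qed (simp add: velocity_nonneg)
qed

end

section \<open>One step of the algorithm\<close>

text \<open>
  Stewart's identity for the point \<open>\<tau> v - (\<tau> - 1) u\<close> on the line through \<open>u\<close> and \<open>v\<close>. It splits the
  energy into distances and velocities.
\<close>

lemma norm_extrapolation:
  fixes v u z :: "'a::real_inner"
  shows "(norm (\<tau> *\<^sub>R v - (\<tau> - 1) *\<^sub>R u - z))\<^sup>2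
    = \<tau> * (\<tau> - 1) * (norm (v - u))\<^sup>2 + \<tau> * (norm (v - z))\<^sup>2 - (\<tau> - 1) * (norm (u - z))\<^sup>2"
  by (simp add: power2_norm_eq_inner inner_diff_left inner_diff_right inner_commute algebra_simps)

text \<open>
  The usual estimate of a gradient step, for a direction \<open>p\<close> that need not be the gradient of \<open>h\<close>: it is
  enough that \<open>p\<close> dominates the gradient along the displacement from the reference point \<open>u\<close>.
\<close>

lemma gradient_step_decrease:
  fixes h :: "'a::real_inner \<Rightarrow> real"
  assumes "convex_on UNIV h" and deriv: "\<And>w. GDERIV h w :> g w"
    and "\<And>w w'. norm (g w - g w') \<le> 1 / s * norm (w - w')" and "0 < s"
    and "g v \<bullet> (v - s *\<^sub>R p - u) \<le> p \<bullet> (v - s *\<^sub>R p - u)"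
  shows "h (v - s *\<^sub>R p) - h u \<le> ((norm (v - u))\<^sup>2 - (norm (v - s *\<^sub>R p - u))\<^sup>2) / (2 * s)"
proof -
  define w where "w = v - s *\<^sub>R p"
  have "h w \<le> h v + g v \<bullet> (w - v) + 1 / s / 2 * (norm (w - v))\<^sup>2"
    by (rule smooth_quadratic_above[OF deriv assms(3)])
  moreover have "h v + g v \<bullet> (u - v) \<le> h u"
    by (rule convex_on_gradient_below[OF assms(1) deriv])
  moreover have "g v \<bullet> (w - v) - g v \<bullet> (u - v) = g v \<bullet> (w - u)"
    by (simp add: inner_diff_right)
  ultimately have "h w - h u \<le> p \<bullet> (w - u) + (norm (w - v))\<^sup>2 / (2 * s)"
    using assms(5) by (simp add: w_def)
  also have "\<dots> = (2 * ((s *\<^sub>R p) \<bullet> (w - u)) + (norm (w - v))\<^sup>2) / (2 * s)"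
    using \<open>0 < s\<close> by (simp add: field_simps)
  also have "2 * ((s *\<^sub>R p) \<bullet> (w - u)) + (norm (w - v))\<^sup>2 = (norm (v - u))\<^sup>2 - (norm (w - u))\<^sup>2"
    by (simp add: w_def power2_norm_eq_inner inner_diff_left inner_diff_right inner_commute algebra_simps)
      (simp add: power2_eq_square)
  finally show ?thesis by (simp add: w_def)
qed

locale mag_gm_run =
  fixes f :: "'m::finite \<Rightarrow> 'a::euclidean_space \<Rightarrow> real"
    and a b s :: real and t :: "nat \<Rightarrow> real" and y x :: "nat \<Rightarrow> 'a"
  assumes convex: "\<And>i. convex_on UNIV (f i)"
    and differentiable: "\<And>i u. f i differentiable (at u)"
    and smooth: "\<And>i u v. norm (grad (f i) u - grad (f i) v) \<le> 1 / s * norm (u - v)"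
    and a_nonneg: "0 \<le> a" and a_less_1: "a < 1" and b_lower: "a\<^sup>2 / 4 \<le> b" and b_upper: "b \<le> 1 / 4"
    and s_pos: "0 < s"
    and run: "mag_gm f a b s t y x"
begin

definition defect :: "nat \<Rightarrow> real" where "defect k = a * t k + (1 / 4 - b)"

definition proj :: "nat \<Rightarrow> 'a" where
  "proj k = closest_point (grad_hull f (y k)) ((1 / s) *\<^sub>R (y k - x k))"

lemma start: "x 0 = x 1" "t 1 = 1"
  using run unfolding mag_gm_def by blast+

lemma t_step: "k \<ge> 1 \<Longrightarrow> t (k + 1) = sqrt ((t k)\<^sup>2 - a * t k + b) + 1 / 2"
  and y_step: "k \<ge> 1 \<Longrightarrow> y k = x k + ((t k - 1) / t (k + 1)) *\<^sub>R (x k - x (k - 1))"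
  and x_step: "k \<ge> 1 \<Longrightarrow> x (k + 1) = y k - s *\<^sub>R proj k"
  using run unfolding mag_gm_def proj_def by blast+

lemma t_square_bounds: "(t k - a / 2)\<^sup>2 \<le> (t k)\<^sup>2 - a * t k + b"
  using b_lower by (simp add: power2_eq_square algebra_simps)

lemma t_increment_lower:
  assumes "k \<ge> 1"
  shows "t k + 1 / 2 - a / 2 \<le> t (k + 1)"
proof -
  have "t k - a / 2 \<le> sqrt ((t k)\<^sup>2 - a * t k + b)"
    using t_square_bounds by (rule real_le_rsqrt)
  then show ?thesis unfolding t_step[OF assms] by linarith
qed

lemma t_ge_1: "k \<ge> 1 \<Longrightarrow> 1 \<le> t k"
proof (induction k rule: dec_induct)
  case base
  then show ?case by (simp add: start(2)[unfolded One_nat_def])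
next
  case (step n)
  then show ?case using t_increment_lower[of n] a_less_1 unfolding Suc_eq_plus1 by linarith
qed

text \<open>
  The bound \<open>b \<ge> a\<^sup>2 / 4\<close> gives growth at the linear rate \<open>(1 - a) / 2\<close>, while \<open>b \<le> 1 / 4\<close> and \<open>a \<ge> 0\<close>
  bound the increments and make the defect nonnegative.
\<close>

sublocale inertial_weights t defect "(1 - a) / 2"
proof
  fix k :: nat
  assume k: "k \<ge> 1"
  show "1 \<le> t k" using t_ge_1[OF k] .
  show "t k \<le> t (k + 1)" using t_increment_lower[OF k] a_less_1 by linarith
  show "(1 - a) / 2 * real k \<le> t k"
    using k
  proof (induction k rule: dec_induct)
    case base
    then show ?case using a_nonneg by (simp add: start(2)[unfolded One_nat_def])
  next
    case (step k)
    then show ?case using t_increment_lower[of k] by (simp add: field_simps)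
  qed
  have radicand: "0 \<le> (t k)\<^sup>2 - a * t k + b"
    using t_square_bounds[of k] zero_le_power2[of "t k - a / 2"] by linarith
  have "(t k)\<^sup>2 - a * t k + b \<le> (t k + 1 / 2)\<^sup>2"
    using t_ge_1[OF k] b_upper mult_nonneg_nonneg[OF a_nonneg order_trans[OF zero_le_one t_ge_1[OF k]]]
    by (simp add: power2_eq_square algebra_simps)
  then have "sqrt ((t k)\<^sup>2 - a * t k + b) \<le> t k + 1 / 2"
    using t_ge_1[OF k] by (intro real_le_lsqrt) auto
  then show "t (k + 1) \<le> t k + 1"
    unfolding t_step[OF k] by simp
  have "(t (k + 1) - 1 / 2)\<^sup>2 = (t k)\<^sup>2 - a * t k + b"
    unfolding t_step[OF k] using radicand by simp
  then show "(t (k + 1))\<^sup>2 - (t k)\<^sup>2 = t (k + 1) - defect k"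
    by (simp add: defect_def power2_eq_square algebra_simps)
  show "0 \<le> defect k"
    using t_ge_1[OF k] a_nonneg b_upper by (simp add: defect_def)
  have ratio: "defect j / t j = a + (1 / 4 - b) / t j" if "1 \<le> t j" for j
    using that by (simp add: defect_def add_divide_distrib)
  have "(1 / 4 - b) / t (k + 1) \<le> (1 / 4 - b) / t k"
    using t_ge_1[OF k] \<open>t k \<le> t (k + 1)\<close> b_upper by (intro divide_left_mono) auto
  then show "defect (k + 1) / t (k + 1) \<le> defect k / t k"
    using t_ge_1[OF k] t_ge_1[of "k + 1"] by (simp add: ratio)
qed (use a_less_1 in simp)

lemma deriv: "GDERIV (f i) u :> grad (f i) u"
  by (rule GDERIV_grad[OF differentiable])

lemma continuous: "continuous_on UNIV (f i)"
  using differentiable by (simp add: continuous_on_eq_continuous_at differentiable_imp_continuous_within)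

lemma grad_hull_props: "convex (grad_hull f u)" "closed (grad_hull f u)" "grad_hull f u \<noteq> {}"
  "grad (f i) u \<in> grad_hull f u"
  unfolding grad_hull_def
  by (auto intro!: compact_imp_closed finite_imp_compact_convex_hull convex_convex_hull hull_inc)

lemma proj_in_hull: "proj k \<in> grad_hull f (y k)"
  unfolding proj_def by (intro closest_point_in_set grad_hull_props)

definition step_sq :: "nat \<Rightarrow> real" where "step_sq k = (norm (x k - x (k - 1)))\<^sup>2"

lemma norm_extrapolation_step:
  assumes "k \<ge> 1"
  shows "(norm (y k - x k))\<^sup>2 = ((t k - 1) / t (k + 1))\<^sup>2 * step_sq k"
  by (simp add: y_step[OF assms] step_sq_def power_mult_distrib power_divide)

text \<open>
  Multiplied by \<open>s\<close>, the variational inequality of the projection says that the direction dominates every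
  gradient along \<open>x (k + 1) - x k\<close>. This is why the projected point is \<open>(y k - x k) / s\<close>: all objectives
  are controlled simultaneously.
\<close>

lemma objective_decrease:
  assumes k: "k \<ge> 1"
  shows "f i (x (k + 1)) - f i (x k) \<le> ((norm (y k - x k))\<^sup>2 - step_sq (k + 1)) / (2 * s)"
proof -
  have "((1 / s) *\<^sub>R (y k - x k) - proj k) \<bullet> (grad (f i) (y k) - proj k) \<le> 0"
    unfolding proj_def by (intro closest_point_dot grad_hull_props)
  then have "s * (((1 / s) *\<^sub>R (y k - x k) - proj k) \<bullet> (grad (f i) (y k) - proj k)) \<le> 0"
    using s_pos by (simp add: mult_le_0_iff)
  also have "s * (((1 / s) *\<^sub>R (y k - x k) - proj k) \<bullet> (grad (f i) (y k) - proj k))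
      = (s *\<^sub>R ((1 / s) *\<^sub>R (y k - x k) - proj k)) \<bullet> (grad (f i) (y k) - proj k)"
    by simp
  also have "s *\<^sub>R ((1 / s) *\<^sub>R (y k - x k) - proj k) = y k - s *\<^sub>R proj k - x k"
    using s_pos by (simp add: algebra_simps)
  finally have "grad (f i) (y k) \<bullet> (y k - s *\<^sub>R proj k - x k) \<le> proj k \<bullet> (y k - s *\<^sub>R proj k - x k)"
    by (simp add: inner_diff_right inner_commute)
  from gradient_step_decrease[OF convex deriv smooth s_pos this]
  show ?thesis by (simp add: x_step[OF k, unfolded One_nat_def add_Suc_right add_0_right] step_sq_def)
qed

text \<open>
  With respect to an arbitrary reference point only some gradient is dominated by the direction, namely
  because the direction is a convex combination of the gradients. One objective suffices as the gap is a
  minimum.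
\<close>

lemma some_objective_gap:
  assumes k: "k \<ge> 1"
  shows "\<exists>i. f i (x (k + 1)) - f i z \<le> ((norm (y k - z))\<^sup>2 - (norm (x (k + 1) - z))\<^sup>2) / (2 * s)"
proof -
  define w where "w = y k - s *\<^sub>R proj k - z"
  have "\<exists>i. grad (f i) (y k) \<bullet> w \<le> proj k \<bullet> w"
  proof (rule ccontr)
    assume "\<not> ?thesis"
    then have "range (\<lambda>i. grad (f i) (y k)) \<subseteq> {g. w \<bullet> g > w \<bullet> proj k}"
      by (auto simp: inner_commute not_le)
    then have "grad_hull f (y k) \<subseteq> {g. w \<bullet> g > w \<bullet> proj k}"
      unfolding grad_hull_def by (rule hull_minimal) (rule convex_halfspace_gt)
    then show False using proj_in_hull[of k] by auto
  qed
  then obtain i where "grad (f i) (y k) \<bullet> (y k - s *\<^sub>R proj k - z) \<le> proj k \<bullet> (y k - s *\<^sub>R proj k - z)"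
    by (auto simp: w_def)
  from gradient_step_decrease[OF convex deriv smooth s_pos this]
  show ?thesis by (auto simp: x_step[OF k, unfolded One_nat_def add_Suc_right add_0_right])
qed

definition gap :: "'a \<Rightarrow> nat \<Rightarrow> real" where
  "gap z k = Min (range (\<lambda>i. f i (x k) - f i z))"

lemma gap_le: "gap z k \<le> f i (x k) - f i z"
  by (simp add: gap_def)

lemma gap_attained: "\<exists>i. gap z k = f i (x k) - f i z"
proof -
  have "gap z k \<in> range (\<lambda>i. f i (x k) - f i z)"
    unfolding gap_def by (rule Min_in) auto
  then show ?thesis by auto
qed

lemma gap_decrease:
  assumes "k \<ge> 1"
  shows "gap z (k + 1) \<le> gap z k + ((norm (y k - x k))\<^sup>2 - step_sq (k + 1)) / (2 * s)"
proof -
  obtain i where "gap z k = f i (x k) - f i z" using gap_attained by blast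
  then show ?thesis
    using gap_le[of z "k + 1" i] objective_decrease[OF assms, of i] by linarith
qed

text \<open>
  In the notation of the introduction, \<open>t k *\<^sub>R x k - (t k - 1) *\<^sub>R x (k - 1)\<close> is \<open>z\<^sub>k\<close>.
\<close>

definition energy :: "'a \<Rightarrow> nat \<Rightarrow> real" where
  "energy z k = 2 * s * (t k)\<^sup>2 * gap z k + (norm (t k *\<^sub>R x k - (t k - 1) *\<^sub>R x (k - 1) - z))\<^sup>2"

text \<open>
  Weight the comparison with \<open>x k\<close> by \<open>\<tau> (\<tau> - 1)\<close> and the comparison with \<open>z\<close> by \<open>\<tau>\<close>, where
  \<open>\<tau> = t (k + 1)\<close>. The squared norms then combine to those of the extrapolated points, and the choice of
  \<open>y k\<close> makes the one at \<open>y k\<close> equal to \<open>z\<^sub>k\<close>.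
\<close>

lemma energy_decrease:
  assumes k: "k \<ge> 1"
  shows "energy z (k + 1) \<le> energy z k - defect k * (2 * s * gap z k)"
proof -
  define \<tau> where "\<tau> = t (k + 1)"
  have \<tau>: "1 \<le> \<tau>" using t_ge_1 by (simp add: \<tau>_def)
  obtain i where i: "f i (x (k + 1)) - f i z \<le> ((norm (y k - z))\<^sup>2 - (norm (x (k + 1) - z))\<^sup>2) / (2 * s)"
    using some_objective_gap[OF k] by blast
  have "gap z (k + 1) \<le> ((norm (y k - z))\<^sup>2 - (norm (x (k + 1) - z))\<^sup>2) / (2 * s)"
    using gap_le i by (rule order_trans)
  then have "2 * s * gap z (k + 1) \<le> (norm (y k - z))\<^sup>2 - (norm (x (k + 1) - z))\<^sup>2"
    using s_pos by (simp add: field_simps)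
  then have 1: "\<tau> * (2 * s * gap z (k + 1)) \<le> \<tau> * ((norm (y k - z))\<^sup>2 - (norm (x (k + 1) - z))\<^sup>2)"
    using \<tau> by (intro mult_left_mono) auto
  have "2 * s * gap z (k + 1) \<le> 2 * s * gap z k + ((norm (y k - x k))\<^sup>2 - (norm (x (k + 1) - x k))\<^sup>2)"
    using gap_decrease[OF k, of z] s_pos by (simp add: step_sq_def field_simps)
  then have 2: "\<tau> * (\<tau> - 1) * (2 * s * gap z (k + 1))
      \<le> \<tau> * (\<tau> - 1) * (2 * s * gap z k + ((norm (y k - x k))\<^sup>2 - (norm (x (k + 1) - x k))\<^sup>2))"
    using \<tau> by (intro mult_left_mono) auto
  have "\<tau> *\<^sub>R y k = \<tau> *\<^sub>R x k + (t k - 1) *\<^sub>R (x k - x (k - 1))"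
    using \<tau> unfolding y_step[OF k, folded \<tau>_def] by (simp add: scaleR_right_distrib)
  then have "\<tau> *\<^sub>R y k - (\<tau> - 1) *\<^sub>R x k = t k *\<^sub>R x k - (t k - 1) *\<^sub>R x (k - 1)"
    by (simp add: algebra_simps)
  then have "energy z k = 2 * s * (t k)\<^sup>2 * gap z k + (norm (\<tau> *\<^sub>R y k - (\<tau> - 1) *\<^sub>R x k - z))\<^sup>2"
    by (simp add: energy_def)
  moreover have "energy z (k + 1)
      = 2 * s * \<tau>\<^sup>2 * gap z (k + 1) + (norm (\<tau> *\<^sub>R x (k + 1) - (\<tau> - 1) *\<^sub>R x k - z))\<^sup>2"
    by (simp add: energy_def \<tau>_def)
  moreover have "defect k * (2 * s * gap z k) = (\<tau> - \<tau>\<^sup>2 + (t k)\<^sup>2) * (2 * s * gap z k)"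
    using weight_square[OF k] by (simp add: \<tau>_def)
  ultimately show ?thesis
    using 1 2 unfolding norm_extrapolation by (simp add: algebra_simps power2_eq_square)
qed

definition mechanical :: "'m \<Rightarrow> nat \<Rightarrow> real" where
  "mechanical i k = f i (x k) + step_sq k / (2 * s)"

lemma mechanical_decrease:
  assumes k: "k \<ge> 1"
  shows "mechanical i (k + 1) \<le> mechanical i k"
proof -
  have "((t k - 1) / t (k + 1))\<^sup>2 \<le> 1"
    using t_ge_1[OF k] weight_mono[OF k] by (intro power_le_one) auto
  then have "(norm (y k - x k))\<^sup>2 \<le> step_sq k"
    unfolding norm_extrapolation_step[OF k] by (simp add: step_sq_def mult_left_le_one_le)
  then have "((norm (y k - x k))\<^sup>2 - step_sq (k + 1)) / (2 * s) \<le> (step_sq k - step_sq (k + 1)) / (2 * s)"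
    using s_pos by (intro divide_right_mono) auto
  then show ?thesis
    using objective_decrease[OF k, of i] by (simp add: mechanical_def diff_divide_distrib)
qed

text \<open>
  The reference points for which the gap is at least \<open>- step_sq k / (2 * s)\<close> for every \<open>k \<ge> 1\<close>.
\<close>

definition minorant :: "'a \<Rightarrow> bool" where
  "minorant z \<longleftrightarrow> (\<forall>i. \<forall>k\<ge>1. f i z \<le> mechanical i k)"

lemma inertial_energy_minorant:
  assumes "minorant z"
  shows "inertial_energy t defect ((1 - a) / 2) (energy z) (\<lambda>k. (t k)\<^sup>2 * (2 * s * gap z k + step_sq k)) step_sq
    (\<lambda>k. (norm (x k - z))\<^sup>2)"
proof unfold_locales
  fix k :: nat
  assume k: "k \<ge> 1"
  have t: "1 \<le> t k" "1 \<le> t (k + 1)" using t_ge_1 k by auto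
  then have cancel: "(t k)\<^sup>2 * (2 * s * gap z k + step_sq k) / (t k)\<^sup>2 = 2 * s * gap z k + step_sq k" by simp
  show "energy z (k + 1) \<le> energy z k - defect k * ((t k)\<^sup>2 * (2 * s * gap z k + step_sq k) / (t k)\<^sup>2 - step_sq k)"
    unfolding cancel using energy_decrease[OF k] by simp
  show "energy z k = (t k)\<^sup>2 * (2 * s * gap z k + step_sq k) - t k * step_sq k
      + t k * (norm (x k - z))\<^sup>2 - (t k - 1) * (norm (x (k - 1) - z))\<^sup>2"
    unfolding energy_def norm_extrapolation step_sq_def by (simp add: algebra_simps power2_eq_square)
  obtain i where "gap z k = f i (x k) - f i z" using gap_attained by blast
  moreover have "f i z \<le> f i (x k) + step_sq k / (2 * s)"
    using assms k by (simp add: minorant_def mechanical_def)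
  ultimately have "0 \<le> 2 * s * (gap z k + step_sq k / (2 * s))"
    using s_pos by simp
  then have "0 \<le> 2 * s * gap z k + step_sq k"
    using s_pos by (simp add: distrib_left)
  then show "0 \<le> (t k)\<^sup>2 * (2 * s * gap z k + step_sq k)" by simp
  have "2 * s * gap z (k + 1) + step_sq (k + 1) \<le> 2 * s * gap z k + (norm (y k - x k))\<^sup>2"
    using gap_decrease[OF k, of z] s_pos by (simp add: field_simps)
  then have "(t (k + 1))\<^sup>2 * (2 * s * gap z (k + 1) + step_sq (k + 1))
      \<le> (t (k + 1))\<^sup>2 * (2 * s * gap z k + (norm (y k - x k))\<^sup>2)"
    by (rule mult_left_mono) simp
  also have "\<dots> = (t (k + 1))\<^sup>2 * (2 * s * gap z k) + (t k - 1)\<^sup>2 * step_sq k"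
    unfolding norm_extrapolation_step[OF k] using t by (simp add: distrib_left power_divide)
  finally show "(t (k + 1))\<^sup>2 * (2 * s * gap z (k + 1) + step_sq (k + 1))
    \<le> (t k)\<^sup>2 * (2 * s * gap z k + step_sq k)
      + ((t (k + 1))\<^sup>2 - (t k)\<^sup>2) * ((t k)\<^sup>2 * (2 * s * gap z k + step_sq k) / (t k)\<^sup>2)
      - ((t (k + 1))\<^sup>2 - (t k - 1)\<^sup>2) * step_sq k"
    unfolding cancel by (simp add: algebra_simps)
qed (auto simp: step_sq_def)

section \<open>Cluster points and convergence\<close>

lemma mechanical_antimono: "1 \<le> j \<Longrightarrow> j \<le> k \<Longrightarrow> mechanical i k \<le> mechanical i j"
  by (rule eventually_antimono_le[of 1]) (rule mechanical_decrease)

lemma f_le_mechanical: "f i (x k) \<le> mechanical i k"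
  using s_pos by (simp add: mechanical_def step_sq_def)

lemma iterates_in_level_set: "x k \<in> level_set f (\<lambda>i. f i (x 1))"
proof (cases "k = 0")
  case False
  have "f i (x k) \<le> f i (x 1)" for i
  proof -
    have "f i (x k) \<le> mechanical i 1"
      using f_le_mechanical[of i k] mechanical_antimono[of 1 k i] False by simp
    then show ?thesis by (simp add: mechanical_def step_sq_def start)
  qed
  then show ?thesis by (simp add: level_set_def)
qed (use start in \<open>simp add: level_set_def\<close>)

lemma objective_tendsto:
  "u \<longlonglongrightarrow> z \<Longrightarrow> (\<lambda>k. f i (u k)) \<longlonglongrightarrow> f i z"
  using continuous[of i] by (auto simp: continuous_on_eq_continuous_at intro: isCont_tendsto_compose)

lemma cluster_point_minorant:
  assumes "strict_mono r" and "(\<lambda>n. x (r n)) \<longlonglongrightarrow> z"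
  shows "minorant z"
  unfolding minorant_def
proof (intro allI impI)
  fix i and k :: nat
  assume k: "k \<ge> 1"
  have "f i (x (r n)) \<le> mechanical i k" if "n \<ge> k" for n
    using f_le_mechanical[of i "r n"] mechanical_antimono[OF k, of "r n" i]
      seq_suble[OF assms(1), of n] that by linarith
  then show "f i z \<le> mechanical i k"
    by (intro LIMSEQ_le_const2[OF objective_tendsto[OF assms(2)]]) blast
qed

lemma cluster_points_equal:
  assumes r: "strict_mono r" "(\<lambda>n. x (r n)) \<longlonglongrightarrow> z"
    and r': "strict_mono r'" "(\<lambda>n. x (r' n)) \<longlonglongrightarrow> z'"
  shows "z = z'"
proof -
  have min: "minorant z" "minorant z'"
    using cluster_point_minorant r r' by blast+
  have step_sq: "step_sq \<longlonglongrightarrow> 0"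
    by (rule inertial_energy.velocity_tendsto_0[OF inertial_energy_minorant[OF min(1)]])
  \<comment> \<open>As the velocity vanishes, the mechanical energies tend to the objective values at a cluster point.\<close>
  have le: "f i w \<le> f i w'"
    if w: "minorant w" and q: "strict_mono q" "(\<lambda>n. x (q n)) \<longlonglongrightarrow> w'" for i w w' q
  proof -
    have "(\<lambda>n. step_sq (q n)) \<longlonglongrightarrow> 0"
      using LIMSEQ_subseq_LIMSEQ[OF step_sq q(1)] by (simp add: o_def)
    then have "(\<lambda>n. mechanical i (q n)) \<longlonglongrightarrow> f i w' + 0 / (2 * s)"
      unfolding mechanical_def using s_pos by (intro tendsto_intros objective_tendsto[OF q(2)]) auto
    moreover have "f i w \<le> mechanical i (q n)" if "n \<ge> 1" for n
      using w seq_suble[OF q(1), of n] that by (simp add: minorant_def)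
    ultimately show ?thesis
      by (intro LIMSEQ_le_const[where X = "\<lambda>n. mechanical i (q n)"]) auto
  qed
  have "f i z = f i z'" for i
    using le[OF min(1) r'] le[OF min(2) r] by (rule order_antisym)
  then have gap: "gap z k = gap z' k" for k by (simp add: gap_def)
  obtain l l' where l: "energy z \<longlonglongrightarrow> l" "energy z' \<longlonglongrightarrow> l'"
    using min inertial_energy.energy_convergent[OF inertial_energy_minorant]
    by (metis convergent_def)
  define h where "h k = x k \<bullet> (z' - z)" for k
  \<comment> \<open>Equal gaps cancel in the difference of the energies, which is thus affine in the extrapolated iterate.\<close>
  have eq: "t k * h k - (t k - 1) * h (k - 1)
      = (energy z k - energy z' k + (norm z')\<^sup>2 - (norm z)\<^sup>2) / 2" for k
    unfolding energy_def gap h_def power2_norm_eq_inner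
    by (simp add: inner_diff_left inner_diff_right inner_commute algebra_simps)
  have "(\<lambda>k. t k * h k - (t k - 1) * h (k - 1)) \<longlonglongrightarrow> (l - l' + (norm z')\<^sup>2 - (norm z)\<^sup>2) / 2"
    unfolding eq by (intro tendsto_intros l) simp
  then have h: "h \<longlonglongrightarrow> (l - l' + (norm z')\<^sup>2 - (norm z)\<^sup>2) / 2"
    by (rule tendsto_if_extrapolation_tendsto)
  have "(\<lambda>n. h (r n)) \<longlonglongrightarrow> z \<bullet> (z' - z)" "(\<lambda>n. h (r' n)) \<longlonglongrightarrow> z' \<bullet> (z' - z)"
    unfolding h_def by (intro tendsto_intros r(2) r'(2))+
  then have "z \<bullet> (z' - z) = z' \<bullet> (z' - z)"
    using LIMSEQ_subseq_LIMSEQ[OF h r(1)] LIMSEQ_subseq_LIMSEQ[OF h r'(1)]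
    by (metis (no_types, lifting) LIMSEQ_unique comp_apply ext)
  then have "(z' - z) \<bullet> (z' - z) = 0" by (simp add: inner_diff_left)
  then show ?thesis by simp
qed

text \<open>
  For a point \<open>u\<close> better in all objectives the gap would eventually exceed some \<open>\<epsilon> > 0\<close>. The energy at \<open>u\<close>
  would then decrease, although its first term is at least \<open>2 s \<epsilon> t k\<^sup>2\<close> and so unbounded.
\<close>

lemma limit_weakly_pareto_optimal:
  assumes "x \<longlonglongrightarrow> z"
  shows "weakly_pareto_optimal f z"
  unfolding weakly_pareto_optimal_def
proof
  assume "\<exists>u. \<forall>i. f i u < f i z"
  then obtain u where u: "\<And>i. f i u < f i z" by blast
  define \<epsilon> where "\<epsilon> = Min (range (\<lambda>i. f i z - f i u)) / 2"
  have \<epsilon>: "0 < \<epsilon>" using u by (simp add: \<epsilon>_def)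
  have "\<epsilon> < f i z - f i u" for i
  proof -
    have "2 * \<epsilon> \<le> f i z - f i u" by (simp add: \<epsilon>_def)
    then show ?thesis using \<epsilon> by linarith
  qed
  then have "\<forall>\<^sub>F k in sequentially. \<epsilon> < f i (x k) - f i u" for i
    by (intro order_tendstoD(1)[OF tendsto_diff[OF objective_tendsto[OF assms] tendsto_const]])
  then have "\<forall>\<^sub>F k in sequentially. \<forall>i. \<epsilon> < f i (x k) - f i u"
    by (simp add: eventually_all_finite)
  then obtain K0 where "\<And>k i. k \<ge> K0 \<Longrightarrow> \<epsilon> < f i (x k) - f i u"
    by (auto simp: eventually_sequentially)
  then obtain K where K: "K \<ge> 1" "\<And>k. k \<ge> K \<Longrightarrow> \<epsilon> \<le> gap u k"
    by (metis gap_attained le_add1 le_add2 le_trans less_imp_le)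
  have "energy u (k + 1) \<le> energy u k" if "k \<ge> K" for k
  proof -
    have "0 \<le> defect k * (2 * s * gap u k)"
      using K(2)[OF that] \<epsilon> s_pos defect_nonneg[of k] K(1) that by simp
    then show ?thesis using energy_decrease[OF le_trans[OF K(1) that], of u] by linarith
  qed
  then have E: "energy u k \<le> energy u K" if "k \<ge> K" for k
    using eventually_antimono_le[of K "energy u" K k] that by simp
  have bound: "2 * s * \<epsilon> * t k \<le> energy u K" if "k \<ge> K" for k
  proof -
    have "2 * s * \<epsilon> * t k \<le> 2 * s * gap u k * (t k)\<^sup>2"
      using K(2)[OF that] K(1) \<epsilon> s_pos t_ge_1[of k] that
      by (intro mult_mono) (auto simp: power2_eq_square)
    also have "\<dots> \<le> energy u k" by (simp add: energy_def)
    finally show ?thesis using E[OF that] by linarith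
  qed
  obtain K' where K': "\<forall>k\<ge>K'. energy u K / (2 * s * \<epsilon>) + 1 \<le> t k"
    using weights_eventually_ge by blast
  have "energy u K / (2 * s * \<epsilon>) + 1 \<le> t (max K K')" "2 * s * \<epsilon> * t (max K K') \<le> energy u K"
    using K' bound by auto
  moreover have "0 < 2 * s * \<epsilon>" using \<epsilon> s_pos by simp
  ultimately have "t (max K K') \<le> energy u K / (2 * s * \<epsilon>)"
    by (simp add: pos_le_divide_eq mult.commute)
  then show False
    using \<open>energy u K / (2 * s * \<epsilon>) + 1 \<le> t (max K K')\<close> by linarith
qed

proposition iterates_converge:
  assumes "bounded (level_set f (\<lambda>i. f i (x 1)))"
  shows "\<exists>z. x \<longlonglongrightarrow> z \<and> weakly_pareto_optimal f z"
proof -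
  have compact: "compact (closure (range x))"
    using bounded_subset[OF assms] iterates_in_level_set by (auto simp: compact_closure image_subset_iff)
  have cluster: "\<exists>w q'. strict_mono q' \<and> (\<lambda>n. x (q (q' n))) \<longlonglongrightarrow> w"
    for q :: "nat \<Rightarrow> nat"
  proof -
    have "\<forall>n. (x \<circ> q) n \<in> closure (range x)"
      using closure_subset by fastforce
    then obtain w q' where "strict_mono q'" "((x \<circ> q) \<circ> q') \<longlonglongrightarrow> w"
      by (rule seq_compactE[OF compact_imp_seq_compact[OF compact]])
    then show ?thesis by (auto simp: o_def)
  qed
  obtain z r where r: "strict_mono r" "(\<lambda>n. x (r n)) \<longlonglongrightarrow> z"
    using cluster[of id] by auto
  have "x \<longlonglongrightarrow> z"
  proof (rule ccontr)
    assume "\<not> x \<longlonglongrightarrow> z"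
    then obtain e where e: "e > 0" "\<exists>\<^sub>\<infinity>n. e \<le> dist (x n) z"
      by (auto simp: tendsto_iff not_eventually not_less cofinite_eq_sequentially INFM_iff_infinite)
    then obtain q :: "nat \<Rightarrow> nat" where q: "strict_mono q" "\<And>n. e \<le> dist (x (q n)) z"
      using infinite_enumerate[of "{n. e \<le> dist (x n) z}"] by (auto simp: INFM_iff_infinite)
    obtain w q' where q': "strict_mono q'" "(\<lambda>n. x (q (q' n))) \<longlonglongrightarrow> w"
      using cluster by blast
    have "z = w"
      using cluster_points_equal[OF r strict_mono_o[OF q(1) q'(1)]] q'(2) by (simp add: o_def)
    then have "\<forall>\<^sub>F n in sequentially. dist (x (q (q' n))) z < e"
      using q'(2) e(1) by (simp add: tendsto_iff)
    then show False
      using q(2) by (auto simp: eventually_sequentially not_less[symmetric])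
  qed
  then show ?thesis using limit_weakly_pareto_optimal by blast
qed

end

theorem theorem4p12:
  fixes f :: "'m::finite \<Rightarrow> real ^ 'n \<Rightarrow> real"
    and L :: "'m \<Rightarrow> real"
    and a b s :: real
    and t :: "nat \<Rightarrow> real"
    and x y :: "nat \<Rightarrow> real ^ 'n"
  assumes "\<And>i. convex_on UNIV (f i)"
    and "\<And>i. continuously_differentiable (f i)"
    and "\<And>i u v. norm (grad (f i) u - grad (f i) v) \<le> L i * norm (u - v)"
    and "\<And>xbar. bounded (level_set f (\<lambda>i. f i xbar))"
    and "\<And>i. bdd_below (range (f i))"
    and "0 \<le> a" and "a < 1"
    and "a\<^sup>2 / 4 \<le> b" and "b \<le> 1 / 4"
    and "0 < s" and "s \<le> 1 / Max (range L)"
    and "mag_gm f a b s t y x"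
  shows "\<exists>xstar. x \<longlonglongrightarrow> xstar \<and> weakly_pareto_optimal f xstar"
proof -
  \<comment> \<open>The positive step size forces \<open>Max (range L)\<close> to be positive: otherwise its reciprocal is at most 0.\<close>
  have "L i \<le> 1 / s" for i
  proof -
    have "0 < Max (range L)"
      using assms(10,11) by (metis divide_le_0_1_iff less_le_trans linorder_not_le)
    then have "Max (range L) \<le> 1 / s"
      using assms(10,11) by (simp add: field_simps)
    moreover have "L i \<le> Max (range L)" by simp
    ultimately show ?thesis by (rule order_trans[rotated])
  qed
  then have smooth: "norm (grad (f i) u - grad (f i) v) \<le> 1 / s * norm (u - v)" for i u v
    using assms(3)[of i u v] by (meson mult_right_mono norm_ge_zero order_trans)
  interpret mag_gm_run f a b s t y x
    by unfold_locales (use assms smooth in \<open>auto simp: continuously_differentiable_def\<close>)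
  show ?thesis
    using assms(4) by (rule iterates_converge)
qed

end
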